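(* Let $X$ be a $T$-variety satisfying the assumptions listed in the context, $\Gamma$ its moment graph and $\mathcal{M}$ the canonical $\Gamma$-sheaf. Let $x<y$ be vertices of $\Gamma$ and $V\subset\mathfrak{t}^*$ a linear subspace. For a $V$-path $x=x_1<x_2<\dots<x_n=y$ with edges $L_i$ joining $x_i$ to $x_{i+1}$, consider the homomorphism $(M_x)_V\to(M_y)_V$ obtained by composing, for $i=1,\dots,n-1$, the maps $$(M_{x_i})_V\to(M_{L_i})_V\xleftarrow{\ \sim\ }(M_{x_{i+1}})_V$$ (the second one inverted). This homomorphism depends only on $x$, $y$ and $V$, and not on the path.
   Context: **The variety.** $T\cong(\mathbb{C}^* )^d$ is an algebraic torus and $X$ is an irreducible complex algebraic variety with an algebraic $T$-action such that: (1a) for every fixed point $x\in X^T$ there are a homomorphism $i\colon\mathbb{C}^*\to T$ and a Zariski open neighborhood $U$ of $x$ with $\lim_{\alpha\to 0}i(\alpha)y=x$ for all $y\in U$ (so $X^T$ is finite); (1b) $X$ has finitely many one-dimensional $T$-orbits; (2) $X$ has a $T$-invariant Whitney stratification by affine spaces. Each stratum contains exactly one fixed point; $C_x$ denotes the stratum containing $x\in X^T$. Every one-dimensional orbit $L$ has exactly two distinct limit points: the fixed point $x$ in the stratum $C_x$ containing $L$, and another fixed point lying in some stratum in the closure of $C_x$. **The moment graph.** $\mathfrak{t}$ is the Lie algebra of $T$. The graph $\Gamma$ has vertex set $\mathcal{V}=X^T$ and edge set $\mathcal{E}$ the set of one-dimensional orbits; $L\in\mathcal{E}$ joins its two limit points.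 The direction $V_L\subset\mathfrak{t}^*$ of $L$ is the one-dimensional annihilator of the Lie algebra of the common stabilizer in $T$ of the points of $L$. The vertices are partially ordered by $x\le y$ iff $C_x\subset\overline{C_y}$. $U_x$ is the set of edges joining $x$ to a vertex $y$ with $x\le y$. There is a unique maximal vertex $x_0$. **$\Gamma$-sheaves.** $A=\mathrm{Sym}(\mathfrak{t}^* )$, graded with $\mathfrak{t}^*$ in degree 2, and $A_L=A/V_LA$. "Module" means finitely generated graded module. For an $A$-module $M$, $\overline{M}=M\otimes_A\mathbb{C}=M/\mathfrak{t}^*M$. A $\Gamma$-sheaf is a triple $(\{M_x\},\{M_L\},\{\rho_{x,L}\})$ with $M_x$ an $A$-module for each $x\in\mathcal{V}$, $M_L$ an $A_L$-module for each $L\in\mathcal{E}$, and $\rho_{x,L}\colon M_x\to M_L$ a homomorphism of $A$-modules whenever $x$ lies on $L$. For a subset $Z$ of $\mathcal{V}\cup\mathcal{E}$, $\mathcal{M}(Z)$ is the module of tuples $(s_a)_{a\in Z}\in\bigoplus_{a\in Z}M_a$ with $\rho_{x,L}(s_x)=s_L$ whenever $x,L\in Z$ and $x$ lies on $L$. **Canonical sheaf $\mathcal{M}$.** A projective cover of an $A$-module $M$ is a free $A$-module $P$ with a surjection $P\to M$ inducing an isomorphism $\overline{P}\to\overline{M}$. Put $M_{x_0}=A$. Inductively, suppose $\mathcal{M}$ is known on the full subgraph $\Gamma_{>x}$ of vertices $y>x$ and all edges joining them. For $L\in U_x$ with upper vertex $y$, put $M_L=M_y/V_LM_y$ with $\rho_{y,L}$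 the quotient map. Let $\widetilde{\Gamma}_{>x}=\Gamma_{>x}\cup U_x$ and let $M_{\partial x}$ be the image of the restriction $\phi\colon\mathcal{M}(\widetilde{\Gamma}_{>x})\to\mathcal{M}(U_x)=\bigoplus_{L\in U_x}M_L$. Let $M_x$ be a projective cover of $M_{\partial x}$; the components of $M_x\to M_{\partial x}\subset\bigoplus_{L\in U_x}M_L$ are the maps $\rho_{x,L}$. **$V$-paths.** For an $A$-module $M$ and a subspace $V\subset\mathfrak{t}^*$, $M_V=M\otimes_A(A/VA)=M/VM$. An increasing path $x=x_1<x_2<\dots<x_n=y$, with $x_i$ joined to $x_{i+1}$ by an edge $L_i$, is a $V$-path if $V_{L_i}\subset V$ for all $i$. In that case the maps $(M_{x_{i+1}})_V\to(M_{L_i})_V$ induced by $\rho_{x_{i+1},L_i}$ are isomorphisms. *)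

theory Defs
  imports "HOL-Analysis.Analysis" "HOL-Algebra.AbelCoset" "HOL-Algebra.Module"
begin

section \<open>Affine spaces, polynomial functions and regular maps\<close>

text \<open>The affine spaces that occur are \<open>complex^'n\<close>, \<open>complex\<close> and products of these; each is
  used with a set \<open>F\<close> of coordinate functions.\<close>

inductive_set poly_alg :: "('e \<Rightarrow> complex) set \<Rightarrow> ('e \<Rightarrow> complex) set"
  for F :: "('e \<Rightarrow> complex) set" where
  const: "(\<lambda>_. c) \<in> poly_alg F"
| gen: "f \<in> F \<Longrightarrow> f \<in> poly_alg F"
| add: "f \<in> poly_alg F \<Longrightarrow> g \<in> poly_alg F \<Longrightarrow> (\<lambda>z. f z + g z) \<in> poly_alg F"
| mult: "f \<in> poly_alg F \<Longrightarrow> g \<in> poly_alg F \<Longrightarrow> (\<lambda>z. f z * g z) \<in> poly_alg F"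

definition coords :: "(complex^'n \<Rightarrow> complex) set" where
  "coords = range (\<lambda>i v. v $ i)"

definition prod_coords ::
  "('e \<Rightarrow> complex) set \<Rightarrow> ('f \<Rightarrow> complex) set \<Rightarrow> ('e \<times> 'f \<Rightarrow> complex) set" where
  "prod_coords F G = (\<lambda>f. f \<circ> fst) ` F \<union> (\<lambda>g. g \<circ> snd) ` G"

definition zariski :: "('e \<Rightarrow> complex) set \<Rightarrow> 'e topology" where
  "zariski F = topology_generated_by ((\<lambda>f. {z. f z \<noteq> 0}) ` poly_alg F)"

definition regular_on :: "('e \<Rightarrow> complex) set \<Rightarrow> 'e set \<Rightarrow> ('e \<Rightarrow> complex) \<Rightarrow> bool" where
  "regular_on F S f \<longleftrightarrow>
     (\<forall>p\<in>S. \<exists>g\<in>poly_alg F. \<exists>h\<in>poly_alg F.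
        h p \<noteq> 0 \<and> (\<forall>q\<in>S. h q \<noteq> 0 \<longrightarrow> f q = g q / h q))"

definition regular_map ::
  "('e \<Rightarrow> complex) set \<Rightarrow> ('f \<Rightarrow> complex) set \<Rightarrow> 'e set \<Rightarrow> ('e \<Rightarrow> 'f) \<Rightarrow> bool" where
  "regular_map F G S f \<longleftrightarrow> (\<forall>g\<in>G. regular_on F S (g \<circ> f))"

definition irreducible_topology :: "'a topology \<Rightarrow> bool" where
  "irreducible_topology \<tau> \<longleftrightarrow> topspace \<tau> \<noteq> {} \<and>
     (\<forall>A B. closedin \<tau> A \<and> closedin \<tau> B \<and> A \<union> B = topspace \<tau> \<longrightarrow>
        A = topspace \<tau> \<or> B = topspace \<tau>)"

definition irreducible_chain :: "'a topology \<Rightarrow> nat \<Rightarrow> (nat \<Rightarrow> 'a set) \<Rightarrow> bool" where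
  "irreducible_chain \<tau> n C \<longleftrightarrow>
     (\<forall>i\<le>n. closedin \<tau> (C i) \<and> irreducible_topology (subtopology \<tau> (C i))) \<and>
     (\<forall>i<n. C i \<subset> C (Suc i))"

text \<open>\<open>\<tau>\<close> has Krull dimension \<open>n\<close>.\<close>

definition has_krull_dim :: "'a topology \<Rightarrow> nat \<Rightarrow> bool" where
  "has_krull_dim \<tau> n \<longleftrightarrow>
     (\<exists>C. irreducible_chain \<tau> n C) \<and> \<not> (\<exists>C. irreducible_chain \<tau> (Suc n) C)"

section \<open>Varieties with a torus action and a stratification\<close>

text \<open>A variety is given by a finite atlas of affine charts \<open>(U, \<phi>)\<close>, where \<open>\<phi>\<close> maps \<open>U\<close>
  bijectively onto a Zariski closed subset of \<open>complex^'n\<close>. As the atlas is finite, the targets of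
  all charts can be taken in one affine space. The torus is \<open>(\<complex>\<^sup>*)\<^sup>d\<close> inside \<open>complex^'d\<close> with
  componentwise multiplication.\<close>

record ('x, 'n, 'd) tvar =
  points :: "'x set"
  charts :: "('x set \<times> ('x \<Rightarrow> complex^'n)) set"
  action :: "complex^'d \<Rightarrow> 'x \<Rightarrow> 'x"
  strata :: "'x set set"

definition glued_topology ::
  "'x set \<Rightarrow> ('x set \<times> ('x \<Rightarrow> 'e)) set \<Rightarrow> 'e topology \<Rightarrow> 'x topology" where
  "glued_topology X At \<tau> = topology (\<lambda>W. W \<subseteq> X \<and>
     (\<forall>(U, \<phi>)\<in>At. openin (subtopology \<tau> (\<phi> ` U)) (\<phi> ` (W \<inter> U))))"

lemma openin_glued_topology:
  assumes "\<And>U \<phi>. (U, \<phi>) \<in> At \<Longrightarrow> inj_on \<phi> U"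
  shows "openin (glued_topology X At \<tau>) W \<longleftrightarrow> W \<subseteq> X \<and>
     (\<forall>(U, \<phi>)\<in>At. openin (subtopology \<tau> (\<phi> ` U)) (\<phi> ` (W \<inter> U)))"
proof -
  have "istopology (\<lambda>W. W \<subseteq> X \<and>
     (\<forall>(U, \<phi>)\<in>At. openin (subtopology \<tau> (\<phi> ` U)) (\<phi> ` (W \<inter> U))))"
    unfolding istopology_def
  proof (rule conjI; clarify)
    fix S T
    assume S: "\<forall>(U, \<phi>)\<in>At. openin (subtopology \<tau> (\<phi> ` U)) (\<phi> ` (S \<inter> U))"
      and T: "\<forall>(U, \<phi>)\<in>At. openin (subtopology \<tau> (\<phi> ` U)) (\<phi> ` (T \<inter> U))" and SX: "S \<subseteq> X"
    have "openin (subtopology \<tau> (\<phi> ` U)) (\<phi> ` (S \<inter> T \<inter> U))" if "(U, \<phi>) \<in> At" for U \<phi>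
    proof -
      have "\<phi> ` (S \<inter> T \<inter> U) = \<phi> ` (S \<inter> U) \<inter> \<phi> ` (T \<inter> U)"
        using assms[OF that] by (auto simp: inj_on_def)
      then show ?thesis using S T that by fastforce
    qed
    then show "S \<inter> T \<subseteq> X \<and>
        (\<forall>(U, \<phi>)\<in>At. openin (subtopology \<tau> (\<phi> ` U)) (\<phi> ` (S \<inter> T \<inter> U)))"
      using SX by auto
  next
    fix K
    assume K: "\<forall>S\<in>K. S \<subseteq> X \<and>
        (\<forall>(U, \<phi>)\<in>At. openin (subtopology \<tau> (\<phi> ` U)) (\<phi> ` (S \<inter> U)))"
    have "openin (subtopology \<tau> (\<phi> ` U)) (\<phi> ` (\<Union>K \<inter> U))" if "(U, \<phi>) \<in> At" for U \<phi>
    proof -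
      have "\<phi> ` (\<Union>K \<inter> U) = \<Union>((\<lambda>S. \<phi> ` (S \<inter> U)) ` K)" by auto
      moreover have "openin (subtopology \<tau> (\<phi> ` U)) (\<Union>((\<lambda>S. \<phi> ` (S \<inter> U)) ` K))"
        using K that by (intro openin_Union) fastforce
      ultimately show ?thesis by simp
    qed
    then show "\<Union>K \<subseteq> X \<and>
        (\<forall>(U, \<phi>)\<in>At. openin (subtopology \<tau> (\<phi> ` U)) (\<phi> ` (\<Union>K \<inter> U)))"
      using K by fast
  qed
  then show ?thesis
    unfolding glued_topology_def by (simp add: topology_inverse')
qed

definition zar :: "('x, 'n::finite, 'd::finite) tvar \<Rightarrow> 'x topology" where
  "zar X = glued_topology (points X) (charts X) (zariski coords)"

definition classical :: "('x, 'n::finite, 'd::finite) tvar \<Rightarrow> 'x topology" where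
  "classical X = glued_topology (points X) (charts X) euclidean"

text \<open>The last condition is that \<open>X\<close> is separated.\<close>

definition complex_variety :: "('x, 'n::finite, 'd::finite) tvar \<Rightarrow> bool" where
  "complex_variety X \<longleftrightarrow>
     finite (charts X) \<and> (\<Union>(U, \<phi>)\<in>charts X. U) = points X \<and>
     (\<forall>(U, \<phi>)\<in>charts X. inj_on \<phi> U \<and> closedin (zariski coords) (\<phi> ` U)) \<and>
     (\<forall>(U, \<phi>)\<in>charts X. \<forall>(W, \<psi>)\<in>charts X.
        openin (subtopology (zariski coords) (\<phi> ` U)) (\<phi> ` (U \<inter> W)) \<and>
        regular_map coords coords (\<phi> ` (U \<inter> W)) (\<psi> \<circ> inv_into U \<phi>) \<and>
        closedin (zariski (prod_coords coords coords)) ((\<lambda>x. (\<phi> x, \<psi> x)) ` (U \<inter> W)))"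

text \<open>Morphisms from a quasi-affine set to \<open>X\<close>, and from a locally closed subset of \<open>X\<close> to an
  affine space.\<close>

definition morphism_into ::
  "('x, 'n::finite, 'd::finite) tvar \<Rightarrow> ('e \<Rightarrow> complex) set \<Rightarrow> 'e set \<Rightarrow> ('e \<Rightarrow> 'x) \<Rightarrow> bool" where
  "morphism_into X F S f \<longleftrightarrow> f ` S \<subseteq> points X \<and>
     (\<forall>(U, \<phi>)\<in>charts X.
        openin (subtopology (zariski F) S) {v\<in>S. f v \<in> U} \<and>
        regular_map F coords {v\<in>S. f v \<in> U} (\<phi> \<circ> f))"

definition morphism_from ::
  "('x, 'n::finite, 'd::finite) tvar \<Rightarrow> ('e \<Rightarrow> complex) set \<Rightarrow> 'x set \<Rightarrow> ('x \<Rightarrow> 'e) \<Rightarrow> bool" where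
  "morphism_from X F S f \<longleftrightarrow>
     (\<forall>(U, \<phi>)\<in>charts X. regular_map coords F (\<phi> ` (S \<inter> U)) (f \<circ> inv_into U \<phi>))"

definition torus :: "(complex^'d) set" where
  "torus = {t. \<forall>i. t $ i \<noteq> 0}"

definition algebraic_action :: "('x, 'n::finite, 'd::finite) tvar \<Rightarrow> bool" where
  "algebraic_action X \<longleftrightarrow>
     (\<forall>t\<in>torus. \<forall>x\<in>points X. action X t x \<in> points X) \<and>
     (\<forall>x\<in>points X. action X 1 x = x) \<and>
     (\<forall>s\<in>torus. \<forall>t\<in>torus. \<forall>x\<in>points X. action X (s * t) x = action X s (action X t x)) \<and>
     (\<forall>(U, \<phi>)\<in>charts X.
        morphism_into X (prod_coords coords coords) (torus \<times> \<phi> ` U)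
          (\<lambda>(t, z). action X t (inv_into U \<phi> z)))"

definition one_parameter_subgroup :: "(complex \<Rightarrow> complex^'d) \<Rightarrow> bool" where
  "one_parameter_subgroup i \<longleftrightarrow> i ` (- {0}) \<subseteq> torus \<and>
     (\<forall>a b. a \<noteq> 0 \<and> b \<noteq> 0 \<longrightarrow> i (a * b) = i a * i b) \<and>
     regular_map {\<lambda>a. a} coords (- {0}) i"

definition fixed_points :: "('x, 'n::finite, 'd::finite) tvar \<Rightarrow> 'x set" where
  "fixed_points X = {x\<in>points X. \<forall>t\<in>torus. action X t x = x}"

definition contracting :: "('x, 'n::finite, 'd::finite) tvar \<Rightarrow> bool" where
  "contracting X \<longleftrightarrow>
     (\<forall>x\<in>fixed_points X. \<exists>i U. one_parameter_subgroup i \<and> openin (zar X) U \<and> x \<in> U \<and>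
        (\<forall>y\<in>U. limitin (classical X) (\<lambda>\<alpha>. action X (i \<alpha>) y) x (at 0)))"

definition orbits :: "('x, 'n::finite, 'd::finite) tvar \<Rightarrow> 'x set set" where
  "orbits X = (\<lambda>x. (\<lambda>t. action X t x) ` torus) ` points X"

definition edges :: "('x, 'n::finite, 'd::finite) tvar \<Rightarrow> 'x set set" where
  "edges X = {L\<in>orbits X. has_krull_dim (subtopology (zar X) L) 1}"

subsection \<open>Whitney stratifications\<close>

text \<open>Affine spaces of varying dimension are realised as coordinate subspaces of \<open>complex^'n\<close>.
  This is enough: the dimension of a locally closed subset of \<open>X\<close> is at most \<open>CARD('n)\<close>.\<close>

definition is_affine_space :: "('x, 'n::finite, 'd::finite) tvar \<Rightarrow> 'x set \<Rightarrow> bool" where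
  "is_affine_space X S \<longleftrightarrow>
     (\<exists>K f g. let E = {v::complex^'n. \<forall>i. i \<notin> K \<longrightarrow> v $ i = 0} in
        bij_betw f E S \<and> (\<forall>v\<in>E. g (f v) = v) \<and>
        morphism_into X coords E f \<and> morphism_from X coords S g)"

text \<open>Zariski tangent space.\<close>

definition tangent_space :: "(complex^'n) set \<Rightarrow> complex^'n \<Rightarrow> (complex^'n) set" where
  "tangent_space Y p =
     {v. \<forall>f\<in>poly_alg coords. (\<forall>y\<in>Y. f y = 0) \<longrightarrow>
        ((\<lambda>s::complex. f (p + s *s v)) has_field_derivative 0) (at 0)}"

text \<open>Convergence in the Grassmannian: for subspaces of the same dimension it suffices that every
  vector of the limit is a limit of vectors of the terms.\<close>

definition subspaces_tend_to :: "(nat \<Rightarrow> (complex^'n) set) \<Rightarrow> (complex^'n) set \<Rightarrow> bool" where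
  "subspaces_tend_to W \<tau> \<longleftrightarrow> vec.subspace \<tau> \<and>
     (\<forall>k. vec.subspace (W k) \<and> vec.dim (W k) = vec.dim \<tau>) \<and>
     (\<forall>v\<in>\<tau>. \<exists>w. (\<forall>k. w k \<in> W k) \<and> w \<longlonglongrightarrow> v)"

definition whitney_a :: "(complex^'n) set \<Rightarrow> (complex^'n) set \<Rightarrow> bool" where
  "whitney_a R S \<longleftrightarrow>
     (\<forall>a y \<tau>. (\<forall>k. a k \<in> R) \<and> y \<in> S \<and> a \<longlonglongrightarrow> y \<and>
        subspaces_tend_to (\<lambda>k. tangent_space R (a k)) \<tau> \<longrightarrow> tangent_space S y \<subseteq> \<tau>)"

definition whitney_b :: "(complex^'n) set \<Rightarrow> (complex^'n) set \<Rightarrow> bool" where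
  "whitney_b R S \<longleftrightarrow>
     (\<forall>a b y u \<tau>. (\<forall>k. a k \<in> R \<and> b k \<in> S \<and> a k \<noteq> b k) \<and> y \<in> S \<and> a \<longlonglongrightarrow> y \<and> b \<longlonglongrightarrow> y \<and>
        (\<lambda>k. (a k - b k) /\<^sub>R norm (a k - b k)) \<longlonglongrightarrow> u \<and>
        subspaces_tend_to (\<lambda>k. tangent_space R (a k)) \<tau> \<longrightarrow> u \<in> \<tau>)"

definition locally_closed_in :: "'a topology \<Rightarrow> 'a set \<Rightarrow> bool" where
  "locally_closed_in \<tau> S \<longleftrightarrow> (\<exists>W Z. openin \<tau> W \<and> closedin \<tau> Z \<and> S = W \<inter> Z)"

text \<open>Smoothness of the strata is not listed because affine spaces are smooth. The Whitney conditions
  are local and independent of the embedding, hence are imposed in the charts.\<close>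

definition whitney_stratification_by_affine_spaces ::
  "('x, 'n::finite, 'd::finite) tvar \<Rightarrow> bool" where
  "whitney_stratification_by_affine_spaces X \<longleftrightarrow>
     finite (strata X) \<and> \<Union>(strata X) = points X \<and>
     (\<forall>S\<in>strata X. S \<noteq> {} \<and> locally_closed_in (zar X) S \<and> is_affine_space X S) \<and>
     (\<forall>R\<in>strata X. \<forall>S\<in>strata X. R \<noteq> S \<longrightarrow> R \<inter> S = {} \<and>
        (R \<inter> zar X closure_of S \<noteq> {} \<longrightarrow> R \<subseteq> zar X closure_of S) \<and>
        (\<forall>(U, \<phi>)\<in>charts X. whitney_a (\<phi> ` (R \<inter> U)) (\<phi> ` (S \<inter> U)) \<and>
                               whitney_b (\<phi> ` (R \<inter> U)) (\<phi> ` (S \<inter> U))))"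

definition strata_invariant :: "('x, 'n::finite, 'd::finite) tvar \<Rightarrow> bool" where
  "strata_invariant X \<longleftrightarrow> (\<forall>S\<in>strata X. \<forall>t\<in>torus. \<forall>x\<in>S. action X t x \<in> S)"

definition stratum :: "('x, 'n::finite, 'd::finite) tvar \<Rightarrow> 'x \<Rightarrow> 'x set" where
  "stratum X x = (THE S. S \<in> strata X \<and> x \<in> S)"

definition limit_points :: "('x, 'n::finite, 'd::finite) tvar \<Rightarrow> 'x set \<Rightarrow> 'x set" where
  "limit_points X L = zar X closure_of L - L"

definition T_variety :: "('x, 'n::finite, 'd::finite) tvar \<Rightarrow> bool" where
  "T_variety X \<longleftrightarrow>
     complex_variety X \<and> irreducible_topology (zar X) \<and> algebraic_action X \<and>
     contracting X \<and> finite (edges X) \<and>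
     whitney_stratification_by_affine_spaces X \<and> strata_invariant X \<and>
     (\<forall>S\<in>strata X. \<exists>!x. x \<in> S \<inter> fixed_points X) \<and>
     (\<forall>L\<in>edges X. \<exists>x\<in>fixed_points X. \<exists>y\<in>fixed_points X. x \<noteq> y \<and> limit_points X L = {x, y} \<and>
        L \<subseteq> stratum X x \<and> stratum X y \<subseteq> zar X closure_of stratum X x)"

section \<open>The moment graph\<close>

text \<open>The Lie algebra of the torus is \<open>complex^'d\<close>, with the componentwise exponential map; the
  Lie algebra of a closed subgroup consists of the tangents to its real one-parameter subgroups.\<close>

definition lie_algebra :: "(complex^'d) set \<Rightarrow> (complex^'d) set" where
  "lie_algebra H = {v. \<forall>s::real. (\<chi> i. exp (of_real s * v $ i)) \<in> H}"

definition tdual :: "(complex^'d \<Rightarrow> complex) set" where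
  "tdual = {f. Vector_Spaces.linear (*s) (*) f}"

definition common_stabilizer :: "('x, 'n::finite, 'd::finite) tvar \<Rightarrow> 'x set \<Rightarrow> (complex^'d) set" where
  "common_stabilizer X L = {t\<in>torus. \<forall>z\<in>L. action X t z = z}"

definition direction :: "('x, 'n::finite, 'd::finite) tvar \<Rightarrow> 'x set \<Rightarrow> (complex^'d \<Rightarrow> complex) set" where
  "direction X L = {f\<in>tdual. \<forall>v\<in>lie_algebra (common_stabilizer X L). f v = 0}"

abbreviation vertices :: "('x, 'n::finite, 'd::finite) tvar \<Rightarrow> 'x set" where
  "vertices X \<equiv> fixed_points X"

definition vle :: "('x, 'n::finite, 'd::finite) tvar \<Rightarrow> 'x \<Rightarrow> 'x \<Rightarrow> bool" where
  "vle X x y \<longleftrightarrow> x \<in> vertices X \<and> y \<in> vertices X \<and> stratum X x \<subseteq> zar X closure_of stratum X y"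

definition vless :: "('x, 'n::finite, 'd::finite) tvar \<Rightarrow> 'x \<Rightarrow> 'x \<Rightarrow> bool" where
  "vless X x y \<longleftrightarrow> vle X x y \<and> x \<noteq> y"

definition lies_on :: "('x, 'n::finite, 'd::finite) tvar \<Rightarrow> 'x \<Rightarrow> 'x set \<Rightarrow> bool" where
  "lies_on X x L \<longleftrightarrow> x \<in> vertices X \<and> L \<in> edges X \<and> x \<in> limit_points X L"

definition joins :: "('x, 'n::finite, 'd::finite) tvar \<Rightarrow> 'x set \<Rightarrow> 'x \<Rightarrow> 'x \<Rightarrow> bool" where
  "joins X L x y \<longleftrightarrow> lies_on X x L \<and> lies_on X y L \<and> x \<noteq> y"

definition up_edges :: "('x, 'n::finite, 'd::finite) tvar \<Rightarrow> 'x \<Rightarrow> 'x set set" where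
  "up_edges X x = {L. \<exists>y. joins X L x y \<and> vle X x y}"

definition vertices_above :: "('x, 'n::finite, 'd::finite) tvar \<Rightarrow> 'x \<Rightarrow> 'x set" where
  "vertices_above X x = {y. vless X x y}"

definition edges_above :: "('x, 'n::finite, 'd::finite) tvar \<Rightarrow> 'x \<Rightarrow> 'x set set" where
  "edges_above X x = {L. \<exists>y z. vless X x y \<and> vless X x z \<and> joins X L y z}"

definition maximal_vertex :: "('x, 'n::finite, 'd::finite) tvar \<Rightarrow> 'x \<Rightarrow> bool" where
  "maximal_vertex X x \<longleftrightarrow> x \<in> vertices X \<and> \<not> (\<exists>y. vless X x y)"

section \<open>Graded modules over \<open>Sym(\<tt>\<^sup>*)\<close>\<close>

text \<open>\<open>Sym(\<tt>\<^sup>*)\<close> is the ring of polynomial functions on \<open>\<tt>\<close>, so that \<open>\<tt>\<^sup>*\<close> is literally a subset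
  of it.\<close>

definition symA :: "(complex^'d \<Rightarrow> complex) ring" where
  "symA = \<lparr>carrier = poly_alg tdual, mult = (\<lambda>f g v. f v * g v), one = (\<lambda>_. 1),
           zero = (\<lambda>_. 0), add = (\<lambda>f g v. f v + g v)\<rparr>"

definition symA_grade :: "int \<Rightarrow> (complex^'d \<Rightarrow> complex) set" where
  "symA_grade n = {f\<in>carrier symA. f = (\<lambda>_. 0) \<or>
     (\<exists>k::nat. n = 2 * int k \<and> (\<forall>c v. f (c *s v) = c ^ k * f v))}"

record ('a, 'b) gmodule = "('a, 'b) module" +
  grade :: "int \<Rightarrow> 'b set"

type_synonym ('d, 'b) amod = "(complex^'d \<Rightarrow> complex, 'b) gmodule"

definition regular_module :: "('d::finite, complex^'d \<Rightarrow> complex) amod" where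
  "regular_module = \<lparr>carrier = carrier symA, mult = mult symA, one = one symA, zero = zero symA,
     add = add symA, smult = mult symA, grade = symA_grade\<rparr>"

text \<open>Finitely generated graded modules.\<close>

definition fg_graded :: "('d::finite, 'b) amod \<Rightarrow> bool" where
  "fg_graded M \<longleftrightarrow> Module.module symA M \<and>
     (\<forall>n. subgroup (grade M n) (add_monoid M)) \<and>
     (\<forall>k n. \<forall>f\<in>symA_grade k. \<forall>m\<in>grade M n. f \<odot>\<^bsub>M\<^esub> m \<in> grade M (k + n)) \<and>
     (\<forall>m\<in>carrier M. \<exists>!c. (\<forall>n. c n \<in> grade M n) \<and> finite {n. c n \<noteq> \<zero>\<^bsub>M\<^esub>} \<and>
        m = finsum M c {n. c n \<noteq> \<zero>\<^bsub>M\<^esub>}) \<and>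
     (\<exists>B. finite B \<and> B \<subseteq> carrier M \<and> (\<forall>N. submodule N symA M \<and> B \<subseteq> N \<longrightarrow> N = carrier M))"

definition graded_free :: "('d::finite, 'b) amod \<Rightarrow> bool" where
  "graded_free P \<longleftrightarrow> fg_graded P \<and>
     (\<exists>B. finite B \<and> B \<subseteq> (\<Union>n. grade P n) \<and>
        (\<forall>m\<in>carrier P. \<exists>!c. c \<in> B \<rightarrow>\<^sub>E carrier symA \<and> m = finsum P (\<lambda>b. c b \<odot>\<^bsub>P\<^esub> b) B))"

definition graded_hom :: "('d::finite, 'b) amod \<Rightarrow> ('d, 'c) amod \<Rightarrow> ('b \<Rightarrow> 'c) \<Rightarrow> bool" where
  "graded_hom M N h \<longleftrightarrow> h \<in> carrier M \<rightarrow> carrier N \<and>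
     (\<forall>m\<in>carrier M. \<forall>m'\<in>carrier M. h (m \<oplus>\<^bsub>M\<^esub> m') = h m \<oplus>\<^bsub>N\<^esub> h m') \<and>
     (\<forall>f\<in>carrier symA. \<forall>m\<in>carrier M. h (f \<odot>\<^bsub>M\<^esub> m) = f \<odot>\<^bsub>N\<^esub> h m) \<and>
     (\<forall>n. h ` grade M n \<subseteq> grade N n)"

definition graded_iso :: "('d::finite, 'b) amod \<Rightarrow> ('d, 'c) amod \<Rightarrow> ('b \<Rightarrow> 'c) \<Rightarrow> bool" where
  "graded_iso M N h \<longleftrightarrow> graded_hom M N h \<and> bij_betw h (carrier M) (carrier N)"

text \<open>\<open>V M\<close>, the quotient \<open>M\<^sub>V = M / V M\<close>, and the map \<open>M\<^sub>V \<rightarrow> N\<^sub>V\<close> induced by \<open>h\<close>. In particular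
  \<open>quot \<tt>\<^sup>* M\<close> is \<open>M \<otimes>\<^sub>A \<complex>\<close>.\<close>

definition subspace_mult ::
  "(complex^'d \<Rightarrow> complex) set \<Rightarrow> ('d::finite, 'b) amod \<Rightarrow> 'b set" where
  "subspace_mult V M =
     \<Inter>{N. submodule N symA M \<and> (\<forall>v\<in>V. \<forall>m\<in>carrier M. v \<odot>\<^bsub>M\<^esub> m \<in> N)}"

definition quot_map ::
  "(complex^'d \<Rightarrow> complex) set \<Rightarrow> ('d::finite, 'b) amod \<Rightarrow> 'b \<Rightarrow> 'b set" where
  "quot_map V M m = subspace_mult V M +>\<^bsub>M\<^esub> m"

definition quot ::
  "(complex^'d \<Rightarrow> complex) set \<Rightarrow> ('d::finite, 'b) amod \<Rightarrow> ('d, 'b set) amod" where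
  "quot V M = \<lparr>carrier = a_rcosets\<^bsub>M\<^esub> (subspace_mult V M), mult = undefined, one = undefined,
     zero = subspace_mult V M, add = set_add M,
     smult = (\<lambda>f C. \<Union>m\<in>C. quot_map V M (f \<odot>\<^bsub>M\<^esub> m)),
     grade = (\<lambda>n. quot_map V M ` grade M n)\<rparr>"

definition induced ::
  "(complex^'d \<Rightarrow> complex) set \<Rightarrow> ('d::finite, 'c) amod \<Rightarrow> ('b \<Rightarrow> 'c) \<Rightarrow> 'b set \<Rightarrow> 'c set" where
  "induced V N h C = (\<Union>m\<in>C. quot_map V N (h m))"

definition projective_cover ::
  "('d::finite, 'b) amod \<Rightarrow> ('d, 'c) amod \<Rightarrow> ('b \<Rightarrow> 'c) \<Rightarrow> bool" where
  "projective_cover P M p \<longleftrightarrow> graded_free P \<and> graded_hom P M p \<and> p ` carrier P = carrier M \<and>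
     graded_iso (quot tdual P) (quot tdual M) (induced tdual M p)"

section \<open>Sheaves on the moment graph\<close>

record ('d, 'x, 'b, 'c) gsheaf =
  vmod :: "'x \<Rightarrow> ('d, 'b) amod"
  emod :: "'x set \<Rightarrow> ('d, 'c) amod"
  rho :: "'x \<Rightarrow> 'x set \<Rightarrow> 'b \<Rightarrow> 'c"

text \<open>A module over \<open>A / V\<^sub>L A\<close> is an \<open>A\<close>-module annihilated by \<open>V\<^sub>L\<close>.\<close>

definition gamma_sheaf ::
  "('x, 'n::finite, 'd::finite) tvar \<Rightarrow> ('d, 'x, 'b, 'c) gsheaf \<Rightarrow> bool" where
  "gamma_sheaf X S \<longleftrightarrow>
     (\<forall>x\<in>vertices X. fg_graded (vmod S x)) \<and>
     (\<forall>L\<in>edges X. fg_graded (emod S L) \<and>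
        (\<forall>v\<in>direction X L. \<forall>m\<in>carrier (emod S L). v \<odot>\<^bsub>emod S L\<^esub> m = \<zero>\<^bsub>emod S L\<^esub>)) \<and>
     (\<forall>x L. lies_on X x L \<longrightarrow> graded_hom (vmod S x) (emod S L) (rho S x L))"

text \<open>The module of sections over the set of vertices \<open>Z\<close> and edges \<open>E\<close>.\<close>

definition sections ::
  "('x, 'n::finite, 'd::finite) tvar \<Rightarrow> ('d, 'x, 'b, 'c) gsheaf \<Rightarrow> 'x set \<Rightarrow> 'x set set \<Rightarrow>
   ('d, ('x \<Rightarrow> 'b) \<times> ('x set \<Rightarrow> 'c)) amod" where
  "sections X S Z E =
    \<lparr>carrier = {(s, r). s \<in> (\<Pi>\<^sub>E x\<in>Z. carrier (vmod S x)) \<and> r \<in> (\<Pi>\<^sub>E L\<in>E. carrier (emod S L)) \<and>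
        (\<forall>x\<in>Z. \<forall>L\<in>E. lies_on X x L \<longrightarrow> rho S x L (s x) = r L)},
     mult = undefined, one = undefined,
     zero = (\<lambda>x\<in>Z. \<zero>\<^bsub>vmod S x\<^esub>, \<lambda>L\<in>E. \<zero>\<^bsub>emod S L\<^esub>),
     add = (\<lambda>(s, r) (s', r'). (\<lambda>x\<in>Z. s x \<oplus>\<^bsub>vmod S x\<^esub> s' x, \<lambda>L\<in>E. r L \<oplus>\<^bsub>emod S L\<^esub> r' L)),
     smult = (\<lambda>f (s, r). (\<lambda>x\<in>Z. f \<odot>\<^bsub>vmod S x\<^esub> s x, \<lambda>L\<in>E. f \<odot>\<^bsub>emod S L\<^esub> r L)),
     grade = (\<lambda>n. {(s, r). s \<in> (\<Pi>\<^sub>E x\<in>Z. grade (vmod S x) n) \<and> r \<in> (\<Pi>\<^sub>E L\<in>E. grade (emod S L) n) \<and>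
        (\<forall>x\<in>Z. \<forall>L\<in>E. lies_on X x L \<longrightarrow> rho S x L (s x) = r L)})\<rparr>"

definition restriction ::
  "'x set \<Rightarrow> 'x set set \<Rightarrow> ('x \<Rightarrow> 'b) \<times> ('x set \<Rightarrow> 'c) \<Rightarrow> ('x \<Rightarrow> 'b) \<times> ('x set \<Rightarrow> 'c)" where
  "restriction Z E = (\<lambda>(s, r). (restrict s Z, restrict r E))"

definition boundary_module ::
  "('x, 'n::finite, 'd::finite) tvar \<Rightarrow> ('d, 'x, 'b, 'c) gsheaf \<Rightarrow> 'x \<Rightarrow>
   ('d, ('x \<Rightarrow> 'b) \<times> ('x set \<Rightarrow> 'c)) amod" where
  "boundary_module X S x =
    (let N = sections X S {} (up_edges X x);
         I = restriction {} (up_edges X x) `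
               carrier (sections X S (vertices_above X x) (edges_above X x \<union> up_edges X x))
     in N\<lparr>carrier := I, grade := \<lambda>n. grade N n \<inter> I\<rparr>)"

text \<open>The maximal vertex is unique as \<open>X\<close> is irreducible. The modules at the vertices are only
  determined up to isomorphism, so \<open>M\<^bsub>x\<^sub>0\<^esub> = A\<close> is read as a graded isomorphism; the edge modules
  are literally the quotients of the modules at the upper vertices.\<close>

definition canonical_sheaf ::
  "('x, 'n::finite, 'd::finite) tvar \<Rightarrow> ('d, 'x, 'b, 'b set) gsheaf \<Rightarrow> bool" where
  "canonical_sheaf X S \<longleftrightarrow> gamma_sheaf X S \<and>
     (\<forall>x. maximal_vertex X x \<longrightarrow> (\<exists>h. graded_iso regular_module (vmod S x) h)) \<and>
     (\<forall>x\<in>vertices X. \<not> maximal_vertex X x \<longrightarrow>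
        (\<forall>L y. joins X L x y \<and> vle X x y \<longrightarrow>
           emod S L = quot (direction X L) (vmod S y) \<and>
           (\<forall>m\<in>carrier (vmod S y). rho S y L m = quot_map (direction X L) (vmod S y) m)) \<and>
        projective_cover (vmod S x) (boundary_module X S x)
          (\<lambda>m. (\<lambda>_. undefined, \<lambda>L\<in>up_edges X x. rho S x L m)))"

definition linear_subspace_tdual :: "(complex^'d \<Rightarrow> complex) set \<Rightarrow> bool" where
  "linear_subspace_tdual V \<longleftrightarrow> V \<subseteq> tdual \<and> (\<lambda>_. 0) \<in> V \<and>
     (\<forall>f\<in>V. \<forall>g\<in>V. (\<lambda>v. f v + g v) \<in> V) \<and> (\<forall>c. \<forall>f\<in>V. (\<lambda>v. c * f v) \<in> V)"

text \<open>The path with vertices \<open>xs\<close> and edges \<open>Ls\<close> is a \<open>V\<close>-path from \<open>x\<close> to \<open>y\<close>.\<close>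

definition V_path ::
  "('x, 'n::finite, 'd::finite) tvar \<Rightarrow> (complex^'d \<Rightarrow> complex) set \<Rightarrow> 'x \<Rightarrow> 'x \<Rightarrow>
   'x list \<Rightarrow> 'x set list \<Rightarrow> bool" where
  "V_path X V x y xs Ls \<longleftrightarrow> length xs = Suc (length Ls) \<and> hd xs = x \<and> last xs = y \<and>
     (\<forall>i<length Ls. vless X (xs ! i) (xs ! Suc i) \<and> joins X (Ls ! i) (xs ! i) (xs ! Suc i) \<and>
        direction X (Ls ! i) \<subseteq> V)"

fun path_map ::
  "('d::finite, 'x, 'b, 'c) gsheaf \<Rightarrow> (complex^'d \<Rightarrow> complex) set \<Rightarrow>
   'x list \<Rightarrow> 'x set list \<Rightarrow> 'b set \<Rightarrow> 'b set" where
  "path_map S V (x # y # xs) (L # Ls) C =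
     path_map S V (y # xs) Ls
       (inv_into (carrier (quot V (vmod S y))) (induced V (emod S L) (rho S y L))
         (induced V (emod S L) (rho S x L) C))"
| "path_map S V _ _ C = C"

end

theory Submission
  imports Defs
begin

text \<open>A section of \<open>\<M>\<close> over the vertices and edges above \<open>x\<close> carries any prescribed element of
  \<open>M\<^sub>x\<close>, because the projective cover maps onto \<open>M\<^bsub>\<partial>x\<^esub>\<close>. Along a \<open>V\<close>-path the
  values of a section at consecutive vertices have the same image in the edge module, so the path
  map sends the class of the value at \<open>x\<close> to the class of the value at \<open>y\<close>. The section does not
  involve the path.\<close>

section \<open>Quotients by subspaces of linear forms\<close>

lemma fg_graded_module: "fg_graded M \<Longrightarrow> module symA M"
  by (simp add: fg_graded_def)

lemma tdual_subset_symA: "tdual \<subseteq> carrier symA"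
  by (auto simp: symA_def intro: poly_alg.gen)

lemma subspace_mult_least:
  assumes "submodule N symA M" "\<And>v m. v \<in> V \<Longrightarrow> m \<in> carrier M \<Longrightarrow> v \<odot>\<^bsub>M\<^esub> m \<in> N"
  shows "subspace_mult V M \<subseteq> N"
  using assms unfolding subspace_mult_def by blast

lemma smult_in_subspace_mult:
  "v \<in> V \<Longrightarrow> m \<in> carrier M \<Longrightarrow> v \<odot>\<^bsub>M\<^esub> m \<in> subspace_mult V M"
  unfolding subspace_mult_def by blast

text \<open>\<open>V M\<close> is an intersection of submodules. Since linear forms lie in
  \<open>symA\<close>, the carrier is a member of the intersected family, which bounds
  \<open>V M\<close> by the carrier.\<close>

lemma submodule_subspace_mult:
  assumes M: "module symA M" and V: "V \<subseteq> tdual"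
  shows "submodule (subspace_mult V M) symA M"
proof -
  interpret module symA M by (rule M)
  have "v \<odot>\<^bsub>M\<^esub> m \<in> carrier M" if "v \<in> V" "m \<in> carrier M" for v m
    using that V tdual_subset_symA by blast
  then have "subspace_mult V M \<subseteq> carrier M"
    by (intro subspace_mult_least carrier_is_submodule)
  moreover have "\<zero>\<^bsub>M\<^esub> \<in> N" if "submodule N symA M" for N
    using subgroup.one_closed[OF submodule.axioms(1)[OF that]] by simp
  moreover note E = submoduleE(3-5)
  ultimately show ?thesis
    by (intro submoduleI) (auto simp: subspace_mult_def intro: E)
qed

lemma subspace_mult_mono: "D \<subseteq> V \<Longrightarrow> subspace_mult D M \<subseteq> subspace_mult V M"
  unfolding subspace_mult_def by blast

lemma carrier_quot: "carrier (quot V M) = quot_map V M ` carrier M"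
  by (auto simp: quot_def quot_map_def A_RCOSETS_def')

lemma abelian_subgroup_subspace_mult:
  assumes M: "module symA M" and V: "V \<subseteq> tdual"
  shows "abelian_subgroup (subspace_mult V M) M"
proof -
  interpret module symA M by (rule M)
  show ?thesis
    using submodule.axioms(1)[OF submodule_subspace_mult[OF assms]] abelian_group_axioms
    by (intro abelian_subgroupI3 additive_subgroupI)
qed

lemma quot_map_self:
  assumes "module symA M" "V \<subseteq> tdual" "a \<in> carrier M"
  shows "a \<in> quot_map V M a"
  unfolding quot_map_def
  by (rule abelian_subgroup.a_rcos_self[OF abelian_subgroup_subspace_mult]) fact+

lemma quot_map_eq_iff:
  assumes M: "module symA M" and V: "V \<subseteq> tdual" and "a \<in> carrier M" "b \<in> carrier M"
  shows "quot_map V M a = quot_map V M b \<longleftrightarrow> a \<ominus>\<^bsub>M\<^esub> b \<in> subspace_mult V M"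
proof -
  interpret abelian_subgroup "subspace_mult V M" M
    by (rule abelian_subgroup_subspace_mult) fact+
  have "quot_map V M a = quot_map V M b \<longleftrightarrow> a \<in> quot_map V M b"
    using quot_map_self[OF M V \<open>a \<in> carrier M\<close>] a_repr_independence[OF _ \<open>b \<in> carrier M\<close> a_subgroup]
    unfolding quot_map_def by metis
  then show ?thesis
    using a_rcos_module[OF assms(4,3)] by (simp add: quot_map_def a_minus_def)
qed

lemma quot_map_subset_carrier:
  assumes "module symA M" "V \<subseteq> tdual" "a \<in> carrier M"
  shows "quot_map V M a \<subseteq> carrier M"
proof -
  interpret abelian_subgroup "subspace_mult V M" M
    by (rule abelian_subgroup_subspace_mult) fact+
  show ?thesis
    unfolding quot_map_def by (rule a_r_coset_subset_G[OF a_subset]) fact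
qed

section \<open>Graded homomorphisms and the maps they induce on quotients\<close>

lemma graded_hom_abelian_group_hom:
  assumes "graded_hom M N h" and M: "module symA M" and N: "module symA N"
  shows "abelian_group_hom M N h"
proof -
  interpret M: module symA M by (rule M)
  interpret N: module symA N by (rule N)
  show ?thesis
    using assms(1) M.abelian_group_axioms N.abelian_group_axioms
    by (intro abelian_group_homI)
       (auto simp: graded_hom_def hom_def intro!: group_hom.intro group_hom_axioms.intro
          M.a_group N.a_group)
qed

lemma graded_hom_diff:
  assumes "graded_hom M N h" "module symA M" "module symA N" "a \<in> carrier M" "b \<in> carrier M"
  shows "h (a \<ominus>\<^bsub>M\<^esub> b) = h a \<ominus>\<^bsub>N\<^esub> h b"
proof -
  interpret abelian_group_hom M N h by (rule graded_hom_abelian_group_hom) fact+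
  show ?thesis using assms(4,5) by (simp add: a_minus_def)
qed

text \<open>Together with the minimality of \<open>V M\<close> this gives
  \<open>h (V M) \<subseteq> V N\<close>.\<close>

lemma submodule_vimage:
  assumes h: "graded_hom M N h" and M: "module symA M" and N: "module symA N"
    and K: "submodule K symA N"
  shows "submodule {m\<in>carrier M. h m \<in> K} symA M"
proof -
  interpret M: module symA M by (rule M)
  interpret N: module symA N by (rule N)
  interpret abelian_group_hom M N h by (rule graded_hom_abelian_group_hom) fact+
  have "\<zero>\<^bsub>N\<^esub> \<in> K"
    using subgroup.one_closed[OF submodule.axioms(1)[OF K]] by simp
  then show ?thesis
    using N.submoduleE[OF K] h
    by (intro M.submoduleI) (auto simp: graded_hom_def)
qed

text \<open>Serves the opposite inclusion: for surjective \<open>h\<close>, minimality of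
  \<open>V N\<close> gives \<open>V N \<subseteq> h (V M)\<close>.\<close>

lemma submodule_image:
  fixes M :: "('d::finite, 'b) amod" and N :: "('d, 'c) amod"
  assumes h: "graded_hom M N h" and M: "module symA M" and N: "module symA N"
    and K: "submodule K symA M"
  shows "submodule (h ` K) symA N"
proof -
  interpret M: module symA M by (rule M)
  interpret N: module symA N by (rule N)
  interpret abelian_group_hom M N h by (rule graded_hom_abelian_group_hom) fact+
  note K' = M.submoduleE[OF K]
  have sub: "k \<in> carrier M" if "k \<in> K" for k using K'(1) that by auto
  have zero: "\<zero>\<^bsub>M\<^esub> \<in> K"
    using subgroup.one_closed[OF submodule.axioms(1)[OF K]] by simp
  show ?thesis
  proof (rule N.submoduleI)
    show "h ` K \<subseteq> carrier N" using sub by auto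
    show "\<zero>\<^bsub>N\<^esub> \<in> h ` K" using zero hom_zero by (metis imageI)
  next
    fix a assume "a \<in> h ` K"
    then obtain k where k: "k \<in> K" "a = h k" by blast
    then show "\<ominus>\<^bsub>N\<^esub> a \<in> h ` K"
      using K'(3) sub by (intro image_eqI[of _ _ "\<ominus>\<^bsub>M\<^esub> k"]) simp_all
  next
    fix a b assume "a \<in> h ` K" "b \<in> h ` K"
    then obtain k l where k: "k \<in> K" "a = h k" and l: "l \<in> K" "b = h l" by blast
    then show "a \<oplus>\<^bsub>N\<^esub> b \<in> h ` K"
      using K'(5) sub by (intro image_eqI[of _ _ "k \<oplus>\<^bsub>M\<^esub> l"]) simp_all
  next
    fix f :: "complex^'d \<Rightarrow> complex" and b assume f: "f \<in> carrier symA" and "b \<in> h ` K"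
    then obtain k where k: "k \<in> K" "b = h k" by blast
    then show "f \<odot>\<^bsub>N\<^esub> b \<in> h ` K"
      using K'(4) sub f h by (intro image_eqI[of _ _ "f \<odot>\<^bsub>M\<^esub> k"]) (simp_all add: graded_hom_def)
  qed
qed

lemma graded_hom_subspace_mult:
  assumes h: "graded_hom M N h" and M: "module symA M" and N: "module symA N" and V: "V \<subseteq> tdual"
    and a: "a \<in> subspace_mult V M"
  shows "h a \<in> subspace_mult V N"
proof -
  have "subspace_mult V M \<subseteq> {m\<in>carrier M. h m \<in> subspace_mult V N}"
  proof (rule subspace_mult_least)
    show "submodule {m\<in>carrier M. h m \<in> subspace_mult V N} symA M"
      by (rule submodule_vimage[OF h M N submodule_subspace_mult[OF N V]])
  next
    fix v m assume vm: "v \<in> V" "m \<in> carrier M"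
    then have v: "v \<in> carrier symA" using V tdual_subset_symA by blast
    then have "h (v \<odot>\<^bsub>M\<^esub> m) = v \<odot>\<^bsub>N\<^esub> h m" "h m \<in> carrier N"
      using h vm by (auto simp: graded_hom_def)
    then show "v \<odot>\<^bsub>M\<^esub> m \<in> {m\<in>carrier M. h m \<in> subspace_mult V N}"
      using smult_in_subspace_mult[OF vm(1)] module.smult_closed[OF M v vm(2)] by simp
  qed
  then show ?thesis using a by blast
qed

text \<open>\<open>induced\<close> is a union over all representatives of a coset. Since
  \<open>h\<close> sends \<open>V M\<close> into \<open>V N\<close>, they all contribute the same
  coset and the union collapses to it.\<close>

lemma induced_quot_map:
  assumes h: "graded_hom M N h" and M: "module symA M" and N: "module symA N" and V: "V \<subseteq> tdual"
    and a: "a \<in> carrier M"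
  shows "induced V N h (quot_map V M a) = quot_map V N (h a)"
proof -
  have "quot_map V N (h b) = quot_map V N (h a)" if b: "b \<in> quot_map V M a" for b
  proof -
    interpret abelian_subgroup "subspace_mult V M" M
      by (rule abelian_subgroup_subspace_mult) fact+
    have bc: "b \<in> carrier M" using quot_map_subset_carrier[OF M V a] b by blast
    have "quot_map V M b = quot_map V M a"
      using a_repr_independence[OF _ a a_subgroup] b by (simp add: quot_map_def)
    then have "h (b \<ominus>\<^bsub>M\<^esub> a) \<in> subspace_mult V N"
      using quot_map_eq_iff[OF M V bc a] graded_hom_subspace_mult[OF h M N V] by blast
    moreover have "h b \<in> carrier N" "h a \<in> carrier N"
      using h a bc by (auto simp: graded_hom_def)
    ultimately show ?thesis
      using graded_hom_diff[OF h M N bc a] quot_map_eq_iff[OF N V] by simp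
  qed
  then show ?thesis
    using quot_map_self[OF M V a] unfolding induced_def by blast
qed

text \<open>The image of \<open>V M\<close> contains \<open>V N\<close> as \<open>h\<close> is onto, so \<open>h a - h b \<in> V N\<close> puts
  \<open>a - b\<close> into \<open>V M + ker h = V M\<close>.\<close>

lemma inj_on_induced:
  assumes h: "graded_hom M N h" and M: "module symA M" and N: "module symA N" and V: "V \<subseteq> tdual"
    and surj: "carrier N \<subseteq> h ` carrier M"
    and ker: "\<And>a b. a \<in> carrier M \<Longrightarrow> b \<in> carrier M \<Longrightarrow> h a = h b \<Longrightarrow> a \<ominus>\<^bsub>M\<^esub> b \<in> subspace_mult V M"
  shows "inj_on (induced V N h) (carrier (quot V M))"
proof (rule inj_onI)
  fix B C assume "B \<in> carrier (quot V M)" "C \<in> carrier (quot V M)"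
    and eq: "induced V N h B = induced V N h C"
  then obtain a b where ab: "a \<in> carrier M" "b \<in> carrier M"
    and BC: "B = quot_map V M a" "C = quot_map V M b"
    by (auto simp: carrier_quot)
  interpret module symA M by (rule M)
  interpret S: abelian_subgroup "subspace_mult V M" M
    by (rule abelian_subgroup_subspace_mult) fact+
  have hc: "h m \<in> carrier N" if "m \<in> carrier M" for m
    using h that by (auto simp: graded_hom_def)
  have "subspace_mult V N \<subseteq> h ` subspace_mult V M"
  proof (rule subspace_mult_least)
    show "submodule (h ` subspace_mult V M) symA N"
      by (rule submodule_image[OF h M N submodule_subspace_mult[OF M V]])
  next
    fix v n assume v: "v \<in> V" and "n \<in> carrier N"
    then obtain m where m: "m \<in> carrier M" "n = h m" using surj by blast
    have "v \<odot>\<^bsub>N\<^esub> n = h (v \<odot>\<^bsub>M\<^esub> m)"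
      using h m v V tdual_subset_symA by (auto simp: graded_hom_def)
    then show "v \<odot>\<^bsub>N\<^esub> n \<in> h ` subspace_mult V M"
      using smult_in_subspace_mult[OF v m(1)] by blast
  qed
  moreover have "h a \<ominus>\<^bsub>N\<^esub> h b \<in> subspace_mult V N"
    using eq ab by (simp add: BC induced_quot_map[OF h M N V] quot_map_eq_iff[OF N V] hc)
  ultimately obtain c where c: "c \<in> subspace_mult V M" "h (a \<ominus>\<^bsub>M\<^esub> b) = h c"
    using graded_hom_diff[OF h M N ab] by auto
  then have cc: "c \<in> carrier M" using S.a_subset by blast
  \<comment> \<open>\<open>a - b\<close> and \<open>c\<close> have the same image under
    \<open>h\<close>, so \<open>ker\<close> applies to this pair; adding \<open>c\<close> back stays
    in \<open>V M\<close>.\<close>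
  have "(a \<ominus>\<^bsub>M\<^esub> b) \<ominus>\<^bsub>M\<^esub> c \<in> subspace_mult V M"
    using ker[OF _ cc] c ab by simp
  then have "((a \<ominus>\<^bsub>M\<^esub> b) \<ominus>\<^bsub>M\<^esub> c) \<oplus>\<^bsub>M\<^esub> c \<in> subspace_mult V M"
    using c by blast
  then have "a \<ominus>\<^bsub>M\<^esub> b \<in> subspace_mult V M"
    using ab cc by (simp add: a_minus_def M.a_assoc M.l_neg)
  then show "B = C" using ab by (simp add: BC quot_map_eq_iff[OF M V])
qed

section \<open>The order on the vertices\<close>

lemma strata_disjoint:
  assumes "T_variety X" "R \<in> strata X" "S \<in> strata X" "p \<in> R" "p \<in> S"
  shows "R = S"
proof (rule ccontr)
  assume "R \<noteq> S"
  moreover have "\<forall>R\<in>strata X. \<forall>S\<in>strata X. R \<noteq> S \<longrightarrow> R \<inter> S = {}"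
    using assms(1) unfolding T_variety_def whitney_stratification_by_affine_spaces_def by simp
  ultimately have "R \<inter> S = {}" using assms(2,3) by simp
  then show False using assms(4,5) by blast
qed

text \<open>Justifies the definite description in \<open>stratum\<close>: the strata cover
  \<open>X\<close> and are disjoint.\<close>

lemma stratum_props:
  assumes X: "T_variety X" and x: "x \<in> vertices X"
  shows "stratum X x \<in> strata X" "x \<in> stratum X x"
proof -
  have "\<Union>(strata X) = points X"
    using X unfolding T_variety_def whitney_stratification_by_affine_spaces_def by simp
  moreover have "x \<in> points X" using x by (simp add: fixed_points_def)
  ultimately obtain S where "S \<in> strata X" "x \<in> S" by blast
  then have "\<exists>!S. S \<in> strata X \<and> x \<in> S" using strata_disjoint[OF X] by blast
  from theI'[OF this] show "stratum X x \<in> strata X" "x \<in> stratum X x"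
    by (auto simp: stratum_def)
qed

lemma vle_trans:
  assumes "vle X x y" "vle X y z"
  shows "vle X x z"
  using assms closure_of_mono[of "stratum X y" "zar X closure_of stratum X z" "zar X"]
  unfolding vle_def by auto

text \<open>Local closedness makes two strata that lie in each other's closure meet. Being disjoint
  or equal, they coincide, and a stratum has only one fixed point.\<close>

lemma vle_antisym:
  assumes X: "T_variety X" and xy: "vle X x y" and yx: "vle X y x"
  shows "x = y"
proof -
  have v: "x \<in> vertices X" "y \<in> vertices X" using xy by (auto simp: vle_def)
  note sx = stratum_props[OF X v(1)] and sy = stratum_props[OF X v(2)]
  have "locally_closed_in (zar X) (stratum X x)"
    using X sx by (simp add: T_variety_def whitney_stratification_by_affine_spaces_def)
  then obtain W Z where W: "openin (zar X) W" and Z: "closedin (zar X) Z"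
    and WZ: "stratum X x = W \<inter> Z"
    by (auto simp: locally_closed_in_def)
  have "x \<in> zar X closure_of stratum X y" using xy sx by (auto simp: vle_def)
  \<comment> \<open>\<open>W\<close> is an open neighborhood of \<open>x\<close>, so it meets the
    stratum of \<open>y\<close>. The point \<open>q\<close> also lies in \<open>Z\<close>, because
    \<open>Z\<close> contains the closure of the stratum of \<open>x\<close>.\<close>
  then obtain q where q: "q \<in> stratum X y" "q \<in> W"
    using W sx WZ unfolding in_closure_of by blast
  have "zar X closure_of stratum X x \<subseteq> Z"
    using Z WZ by (intro closure_of_minimal) auto
  then have "q \<in> stratum X x" using yx q WZ by (auto simp: vle_def)
  then have "stratum X x = stratum X y"
    using q sx sy strata_disjoint[OF X] by blast
  moreover have "\<exists>!x. x \<in> stratum X y \<inter> fixed_points X"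
    using X sy unfolding T_variety_def by simp
  ultimately show ?thesis using sx sy v by (metis IntI)
qed

text \<open>Strictness rests on antisymmetry: \<open>x = z\<close> would give
  \<open>x \<le> y \<le> x\<close>, hence \<open>x = y\<close>.\<close>

lemma vless_trans:
  assumes "T_variety X" "vless X x y" "vless X y z"
  shows "vless X x z"
  unfolding vless_def
proof
  show "vle X x z" using assms(2,3) vle_trans by (auto simp: vless_def)
  show "x \<noteq> z" using assms vle_antisym[of X x y] by (auto simp: vless_def)
qed

section \<open>Sections of the canonical sheaf\<close>

text \<open>The clause of \<open>canonical_sheaf\<close> on upward edges speaks of a lower vertex
  that is not maximal; here \<open>y\<close> above \<open>x\<close> guarantees this.\<close>

lemma canonical_sheaf_up_edge:
  assumes "canonical_sheaf X S" "vless X x y" "joins X L x y"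
  shows "emod S L = quot (direction X L) (vmod S y)"
    and "m \<in> carrier (vmod S y) \<Longrightarrow> rho S y L m = quot_map (direction X L) (vmod S y) m"
proof -
  have x: "x \<in> vertices X" "\<not> maximal_vertex X x" and le: "vle X x y"
    using assms(2) by (auto simp: vless_def vle_def maximal_vertex_def)
  then have "emod S L = quot (direction X L) (vmod S y) \<and>
      (\<forall>m\<in>carrier (vmod S y). rho S y L m = quot_map (direction X L) (vmod S y) m)"
    using assms(1,3) unfolding canonical_sheaf_def by simp
  then show "emod S L = quot (direction X L) (vmod S y)"
    and "m \<in> carrier (vmod S y) \<Longrightarrow> rho S y L m = quot_map (direction X L) (vmod S y) m"
    by blast+
qed

text \<open>The values of \<open>m\<close> on the upward edges extend to a section over everything
  strictly above \<open>x\<close>; placing \<open>m\<close> at \<open>x\<close> completes it. Only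
  the vertex values \<open>t\<close> are kept: the edge values are eliminated by equating the images
  from both ends.\<close>

lemma ex_section_through:
  fixes X :: "('x, 'n::finite, 'd::finite) tvar" and S :: "('d, 'x, 'b, 'b set) gsheaf"
  assumes X: "T_variety X" and S: "canonical_sheaf X S"
    and x: "x \<in> vertices X" "\<not> maximal_vertex X x" and m: "m \<in> carrier (vmod S x)"
  obtains t where "t x = m"
    and "\<And>z. z = x \<or> vless X x z \<Longrightarrow> t z \<in> carrier (vmod S z)"
    and "\<And>u z L. u = x \<or> vless X x u \<Longrightarrow> vless X u z \<Longrightarrow> joins X L u z \<Longrightarrow>
           rho S u L (t u) = rho S z L (t z)"
proof -
  \<comment> \<open>The covering map in \<open>canonical_sheaf\<close>. Its first component is the
    vertex part of a section over no vertices, which is constantly \<open>undefined\<close>.\<close>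
  let ?p = "\<lambda>m. (\<lambda>_::'x. undefined :: 'b, \<lambda>L\<in>up_edges X x. rho S x L m)"
  let ?N = "sections X S (vertices_above X x) (edges_above X x \<union> up_edges X x)"
  have "projective_cover (vmod S x) (boundary_module X S x) ?p"
    using S x unfolding canonical_sheaf_def by simp
  then have "?p ` carrier (vmod S x) = carrier (boundary_module X S x)"
    by (simp add: projective_cover_def)
  then have "?p m \<in> carrier (boundary_module X S x)" using m by blast
  then have "?p m \<in> restriction {} (up_edges X x) ` carrier ?N"
    by (simp add: boundary_module_def Let_def)
  then obtain s r where sr: "(s, r) \<in> carrier ?N"
    and eq: "?p m = restriction {} (up_edges X x) (s, r)"
    by auto
  have r: "r L = rho S x L m" if "L \<in> up_edges X x" for L
    using eq that by (auto simp: restriction_def restrict_def dest: fun_cong[of _ _ L])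
  have s: "s z \<in> carrier (vmod S z)" if "vless X x z" for z
    using sr that by (auto simp: sections_def vertices_above_def PiE_def Pi_def)
  have glue: "rho S z L (s z) = r L"
    if "vless X x z" "lies_on X z L" "L \<in> edges_above X x \<union> up_edges X x" for z L
    using sr that by (auto simp: sections_def vertices_above_def)
  show ?thesis
  \<comment> \<open>\<open>x\<close> is not strictly above itself, so overwriting \<open>s\<close>
    at \<open>x\<close> leaves all values above \<open>x\<close> intact.\<close>
  proof (rule that[of "s(x := m)"])
    show "(s(x := m)) x = m" by simp
    show "(s(x := m)) z \<in> carrier (vmod S z)" if "z = x \<or> vless X x z" for z
      using that s m by auto
    show "rho S u L ((s(x := m)) u) = rho S z L ((s(x := m)) z)"
      if u: "u = x \<or> vless X x u" and uz: "vless X u z" and L: "joins X L u z" for u z L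
    proof -
      have z: "vless X x z" using u uz vless_trans[OF X] by blast
      then have zx: "z \<noteq> x" by (auto simp: vless_def)
      have lies: "lies_on X u L" "lies_on X z L" using L by (auto simp: joins_def)
      show ?thesis
      \<comment> \<open>An edge starting at \<open>x\<close> is an upward edge, where
        \<open>r\<close> is the image of \<open>m\<close>; any other edge has both ends strictly
        above \<open>x\<close>, where \<open>s\<close> is already compatible with
        \<open>r\<close>.\<close>
      proof (cases "u = x")
        case True
        then have "L \<in> up_edges X x" using L uz by (auto simp: up_edges_def vless_def)
        then show ?thesis using glue[OF z lies(2)] r True zx by simp
      next
        case False
        then have "vless X x u" using u by blast
        then have "L \<in> edges_above X x" using L z by (auto simp: edges_above_def)
        then show ?thesis using glue[OF z lies(2)] glue[OF \<open>vless X x u\<close> lies(1)] False zx by simp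
      qed
    qed
  qed
qed

section \<open>Path maps\<close>

text \<open>The classes of \<open>a\<close> and \<open>b\<close> have equal images in the edge
  module modulo \<open>V\<close>, and the map from the upper vertex is injective there, so
  \<open>inv_into\<close> returns the class of \<open>b\<close>.\<close>

lemma path_step:
  assumes S: "canonical_sheaf X S" and V: "V \<subseteq> tdual"
    and xy: "vless X x y" and L: "joins X L x y" and dir: "direction X L \<subseteq> V"
    and a: "a \<in> carrier (vmod S x)" and b: "b \<in> carrier (vmod S y)"
    and eq: "rho S x L a = rho S y L b"
  shows "inv_into (carrier (quot V (vmod S y))) (induced V (emod S L) (rho S y L))
      (induced V (emod S L) (rho S x L) (quot_map V (vmod S x) a)) = quot_map V (vmod S y) b"
proof -
  have lies: "lies_on X x L" "lies_on X y L" using L by (auto simp: joins_def)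
  have mods: "module symA (vmod S x)" "module symA (vmod S y)" "module symA (emod S L)"
    and hom: "graded_hom (vmod S x) (emod S L) (rho S x L)"
      "graded_hom (vmod S y) (emod S L) (rho S y L)"
    using S lies unfolding canonical_sheaf_def gamma_sheaf_def lies_on_def
    by (auto intro: fg_graded_module)
  note E = canonical_sheaf_up_edge[OF S xy L]
  have dirt: "direction X L \<subseteq> tdual" by (auto simp: direction_def)
  have "inj_on (induced V (emod S L) (rho S y L)) (carrier (quot V (vmod S y)))"
  proof (rule inj_on_induced[OF hom(2) mods(2,3) V])
    show "carrier (emod S L) \<subseteq> rho S y L ` carrier (vmod S y)"
      using E by (auto simp: carrier_quot)
  next
    fix c d assume "c \<in> carrier (vmod S y)" "d \<in> carrier (vmod S y)" "rho S y L c = rho S y L d"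
    \<comment> \<open>At the upper vertex \<open>rho\<close> is the quotient map by the edge
      direction, and this direction lies in \<open>V\<close>.\<close>
    then have "c \<ominus>\<^bsub>vmod S y\<^esub> d \<in> subspace_mult (direction X L) (vmod S y)"
      using E(2) quot_map_eq_iff[OF mods(2) dirt] by metis
    then show "c \<ominus>\<^bsub>vmod S y\<^esub> d \<in> subspace_mult V (vmod S y)"
      using subspace_mult_mono[OF dir, of "vmod S y"] by blast
  qed
  moreover have "induced V (emod S L) (rho S x L) (quot_map V (vmod S x) a)
      = induced V (emod S L) (rho S y L) (quot_map V (vmod S y) b)"
    using eq a b hom mods V by (simp add: induced_quot_map)
  moreover have "quot_map V (vmod S y) b \<in> carrier (quot V (vmod S y))"
    using b by (simp add: carrier_quot)
  ultimately show ?thesis by simp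
qed

lemma V_path_Cons:
  assumes "V_path X V x y (a # b # xs) (L # Ls)"
  shows "a = x" "vless X x b" "joins X L x b" "direction X L \<subseteq> V" "V_path X V b y (b # xs) Ls"
proof -
  have A: "\<forall>i<length (L # Ls). vless X ((a # b # xs) ! i) ((a # b # xs) ! Suc i) \<and>
      joins X ((L # Ls) ! i) ((a # b # xs) ! i) ((a # b # xs) ! Suc i) \<and> direction X ((L # Ls) ! i) \<subseteq> V"
    and B: "a = x" "length xs = length Ls" "last (b # xs) = y"
    using assms by (auto simp: V_path_def)
  show "a = x" by fact
  show "vless X x b" "joins X L x b" "direction X L \<subseteq> V"
    using A[rule_format, of 0] B by auto
  show "V_path X V b y (b # xs) Ls"
    unfolding V_path_def
  proof (intro conjI allI impI)
    fix i assume "i < length Ls"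
    then show "vless X ((b # xs) ! i) ((b # xs) ! Suc i)"
      and "joins X (Ls ! i) ((b # xs) ! i) ((b # xs) ! Suc i)" and "direction X (Ls ! i) \<subseteq> V"
      \<comment> \<open>Step \<open>i\<close> of the tail is step \<open>Suc i\<close> of the whole
        path.\<close>
      using A[rule_format, of "Suc i"] by auto
  qed (use B in auto)
qed

text \<open>Induction on the edges. The section stays anchored at \<open>x\<close> while the
  starting vertex \<open>w\<close> varies over \<open>x\<close> and the vertices above it, since the
  tail of a path starts higher up.\<close>

lemma path_map_section:
  assumes X: "T_variety X" and S: "canonical_sheaf X S" and V: "V \<subseteq> tdual"
    and carr: "\<And>z. z = x \<or> vless X x z \<Longrightarrow> t z \<in> carrier (vmod S z)"
    and glue: "\<And>u z L. u = x \<or> vless X x u \<Longrightarrow> vless X u z \<Longrightarrow> joins X L u z \<Longrightarrow>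
           rho S u L (t u) = rho S z L (t z)"
  shows "V_path X V w y xs Ls \<Longrightarrow> w = x \<or> vless X x w \<Longrightarrow>
    path_map S V xs Ls (quot_map V (vmod S w) (t w)) = quot_map V (vmod S y) (t y)"
proof (induction Ls arbitrary: w xs)
  case Nil
  then have "length xs = 1" "hd xs = w" "last xs = y" by (auto simp: V_path_def)
  then show ?case by (cases xs) auto
next
  case (Cons L Ls)
  from Cons.prems(1) obtain a b xs' where xs: "xs = a # b # xs'"
    by (auto simp: V_path_def length_Suc_conv)
  note path = V_path_Cons[OF Cons.prems(1)[unfolded xs]]
  have b: "vless X x b" using path(2) Cons.prems(2) vless_trans[OF X] by blast
  have "inv_into (carrier (quot V (vmod S b))) (induced V (emod S L) (rho S b L))
      (induced V (emod S L) (rho S w L) (quot_map V (vmod S w) (t w))) = quot_map V (vmod S b) (t b)"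
    using path Cons.prems(2) b by (intro path_step[OF S V] carr glue) auto
  then show ?case
    using Cons.IH[OF path(5)] b path(1) by (simp add: xs)
qed

theorem proposition1p9:
  fixes X :: "('x, 'n::finite, 'd::finite) tvar"
    and M :: "('d, 'x, 'b, 'b set) gsheaf"
    and x y :: 'x
    and V :: "(complex^'d \<Rightarrow> complex) set"
    and xs xs' :: "'x list" and Ls Ls' :: "'x set list"
    and C :: "'b set"
  assumes "T_variety X"
    and "canonical_sheaf X M"
    and "x \<in> vertices X" and "y \<in> vertices X" and "vless X x y"
    and "linear_subspace_tdual V"
    and "V_path X V x y xs Ls"
    and "V_path X V x y xs' Ls'"
    and "C \<in> carrier (quot V (vmod M x))"
  shows "path_map M V xs Ls C = path_map M V xs' Ls' C"
proof -
  have V: "V \<subseteq> tdual" using assms(6) by (simp add: linear_subspace_tdual_def)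
  \<comment> \<open>The projective cover clause holds at \<open>x\<close> because \<open>y\<close>
    lies above it.\<close>
  have max: "\<not> maximal_vertex X x" using assms(5) by (auto simp: maximal_vertex_def)
  obtain m where m: "m \<in> carrier (vmod M x)" and C: "C = quot_map V (vmod M x) m"
    using assms(9) by (auto simp: carrier_quot)
  obtain t where t: "t x = m"
    and carr: "\<And>z. z = x \<or> vless X x z \<Longrightarrow> t z \<in> carrier (vmod M z)"
    and glue: "\<And>u z L. u = x \<or> vless X x u \<Longrightarrow> vless X u z \<Longrightarrow> joins X L u z \<Longrightarrow>
           rho M u L (t u) = rho M z L (t z)"
    using ex_section_through[OF assms(1,2,3) max m] by blast
  \<comment> \<open>\<open>t\<close> was chosen before any path, so the right-hand side is the same
    for all of them.\<close>
  have "path_map M V ys Ks C = quot_map V (vmod M y) (t y)" if "V_path X V x y ys Ks" for ys Ks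
    using path_map_section[of X M V x t, OF assms(1,2) V carr glue that] t C by auto
  then show ?thesis using assms(7,8) by simp
qed

end
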